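(* Suppose that each $P\in\mathcal{P}$ is supported and that $\mathcal{P}$ is countably convex. For any $S\in\mathcal{S}$, the following are equivalent: (i) $\operatorname{NA}(\mathcal{P},S)$ holds. (ii) For all $P\in\mathcal{P}$ there exists $Q\in\mathfrak{M}_\ll(S)$ such that $P\ll Q$.
   Context: $(\Omega,\mathcal{F})$ is a measurable space and $\mathcal{P}$ is a non-empty set of probability measures on it; $c(A):=\sup_{P\in\mathcal{P}}P(A)$ for $A\in\mathcal{F}$. An event $A\in\mathcal{F}$ is $\mathcal{P}$-polar if $c(A)=0$; a property holds $\mathcal{P}$-q.s. if it holds outside a $\mathcal{P}$-polar event. $\mathfrak{P}_c(\Omega)$ is the set of probability measures on $(\Omega,\mathcal{F})$ vanishing on all $\mathcal{P}$-polar events. $Q\in\mathfrak{P}_c(\Omega)$ is supported if there is $S(Q)\in\mathcal{F}$ such that $Q(S(Q)^c)=0$ and, whenever $N\in\mathcal{F}$ satisfies $Q(N)=0$, $N\cap S(Q)$ is $\mathcal{P}$-polar. $\mathcal{P}$ is countably convex if $\sum_{n\in\mathbb{N}}\alpha_nP_n\in\mathcal{P}$ whenever $P_n\in\mathcal{P}$ for all $n\in\mathbb{N}$ and $(\alpha_n)_{n\in\mathbb{N}}$ are non-negative reals summing to $1$. A one-period market model of dimension $d\in\mathbb{N}$ is $S=(S_0,S_1)$ with $S_0\in\mathbb{R}^d$ and $S_1$ a bounded $d$-dimensional random vector on $(\Omega,\mathcal{F})$, all coordinates of $S_0,S_1$ being non-negative; $\mathcal{S}$ is the collection of all such models of all dimensions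 $d\in\mathbb{N}$; $d(S)$ is the dimension of $S$; $\Delta S:=S_1-S_0$; for $H\in\mathbb{R}^{d(S)}$, $H\Delta S$ is the ($\omega$-wise) Euclidean scalar product. $\operatorname{NA}(\mathcal{P},S)$ holds if for all $H\in\mathbb{R}^{d(S)}$, $H\Delta S\ge0$ $\mathcal{P}$-q.s. implies $H\Delta S=0$ $\mathcal{P}$-q.s. $\mathfrak{M}(S):=\{Q\in\mathfrak{P}_c(\Omega)\mid E_Q[\Delta S^i]=0\text{ for all }i=1,\dots,d(S)\}$ and $\mathfrak{M}_\ll(S):=\{Q\in\mathfrak{M}(S)\mid\exists P\in\mathcal{P}\colon Q\ll P\}$. *)

theory Defs
  imports "HOL-Probability.Probability"
begin

(* Throughout, the measurable space (Omega, F) is given by (space M, sets M); the measure carried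
   by M itself is irrelevant. The probability measures on (Omega, F) are the elements of
   space (prob_algebra M), and PP is the set of priors. *)

definition capacity :: "'a measure set \<Rightarrow> 'a set \<Rightarrow> ennreal" where
  "capacity PP A = (SUP P\<in>PP. emeasure P A)"

definition polar :: "'a measure \<Rightarrow> 'a measure set \<Rightarrow> 'a set \<Rightarrow> bool" where
  "polar M PP A \<longleftrightarrow> A \<in> sets M \<and> capacity PP A = 0"

definition quasi_surely :: "'a measure \<Rightarrow> 'a measure set \<Rightarrow> ('a \<Rightarrow> bool) \<Rightarrow> bool" where
  "quasi_surely M PP \<phi> \<longleftrightarrow> (\<exists>N. polar M PP N \<and> (\<forall>\<omega>\<in>space M - N. \<phi> \<omega>))"

definition prob_c :: "'a measure \<Rightarrow> 'a measure set \<Rightarrow> 'a measure set" where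
  "prob_c M PP = {Q \<in> space (prob_algebra M). \<forall>N. polar M PP N \<longrightarrow> emeasure Q N = 0}"

definition supported :: "'a measure \<Rightarrow> 'a measure set \<Rightarrow> 'a measure \<Rightarrow> bool" where
  "supported M PP Q \<longleftrightarrow> Q \<in> prob_c M PP \<and>
     (\<exists>S\<in>sets M. emeasure Q (space M - S) = 0 \<and>
        (\<forall>N\<in>sets M. emeasure Q N = 0 \<longrightarrow> polar M PP (N \<inter> S)))"

definition countable_mixture ::
    "'a measure \<Rightarrow> (nat \<Rightarrow> real) \<Rightarrow> (nat \<Rightarrow> 'a measure) \<Rightarrow> 'a measure" where
  "countable_mixture M \<alpha> P =
     measure_of (space M) (sets M) (\<lambda>A. \<Sum>n. ennreal (\<alpha> n) * emeasure (P n) A)"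

(* measure_of yields the null measure if its argument is not a measure; the next lemma shows that
   this default case does not occur here. *)
lemma emeasure_countable_mixture:
  assumes "\<And>n. sets (P n) = sets M" and "A \<in> sets M"
  shows "emeasure (countable_mixture M \<alpha> P) A = (\<Sum>n. ennreal (\<alpha> n) * emeasure (P n) A)"
  unfolding countable_mixture_def
proof (rule emeasure_measure_of_sigma)
  show "sigma_algebra (space M) (sets M)" by (rule sets.sigma_algebra_axioms)
  show "positive (sets M) (\<lambda>A. \<Sum>n. ennreal (\<alpha> n) * emeasure (P n) A)"
    by (simp add: positive_def)
  show "countably_additive (sets M) (\<lambda>A. \<Sum>n. ennreal (\<alpha> n) * emeasure (P n) A)"
  proof (rule countably_additiveI)
    fix B :: "nat \<Rightarrow> 'a set"
    assume B: "range B \<subseteq> sets M" "disjoint_family B"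
    have "(\<Sum>i. \<Sum>n. ennreal (\<alpha> n) * emeasure (P n) (B i))
        = (\<Sum>n. \<Sum>i. ennreal (\<alpha> n) * emeasure (P n) (B i))"
      by (rule pair_sigma_finite.Fubini'[of "count_space UNIV" "count_space UNIV"
            "\<lambda>n i. ennreal (\<alpha> n) * emeasure (P n) (B i)", unfolded nn_integral_count_space_nat])
        (auto intro: pair_sigma_finite.intro sigma_finite_measure_count_space)
    also have "\<dots> = (\<Sum>n. ennreal (\<alpha> n) * emeasure (P n) (\<Union>i. B i))"
      using B assms(1) by (simp add: suminf_emeasure)
    finally show "(\<Sum>i. \<Sum>n. ennreal (\<alpha> n) * emeasure (P n) (B i))
        = (\<Sum>n. ennreal (\<alpha> n) * emeasure (P n) (\<Union>i. B i))" .
  qed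
qed (rule assms(2))

definition countably_convex :: "'a measure \<Rightarrow> 'a measure set \<Rightarrow> bool" where
  "countably_convex M PP \<longleftrightarrow>
     (\<forall>P \<alpha>. (\<forall>n. P n \<in> PP) \<longrightarrow> (\<forall>n. 0 \<le> \<alpha> n) \<longrightarrow> \<alpha> sums 1 \<longrightarrow> countable_mixture M \<alpha> P \<in> PP)"

(* A model (S0, S1) of dimension CARD('d) >= 1; the dimension is the index type 'd. *)
definition market_models :: "'a measure \<Rightarrow> ((real ^ 'd) \<times> ('a \<Rightarrow> real ^ 'd)) set" where
  "market_models M = {(S0, S1). S1 \<in> borel_measurable M \<and> bounded (S1 ` space M) \<and>
     (\<forall>i. 0 \<le> S0 $ i) \<and> (\<forall>\<omega>\<in>space M. \<forall>i. 0 \<le> S1 \<omega> $ i)}"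

definition increment :: "(real ^ 'd) \<times> ('a \<Rightarrow> real ^ 'd) \<Rightarrow> 'a \<Rightarrow> real ^ 'd" where
  "increment S \<omega> = snd S \<omega> - fst S"

definition no_arbitrage ::
    "'a measure \<Rightarrow> 'a measure set \<Rightarrow> (real ^ 'd) \<times> ('a \<Rightarrow> real ^ 'd) \<Rightarrow> bool" where
  "no_arbitrage M PP S \<longleftrightarrow>
     (\<forall>H :: real ^ 'd. quasi_surely M PP (\<lambda>\<omega>. 0 \<le> H \<bullet> increment S \<omega>) \<longrightarrow>
        quasi_surely M PP (\<lambda>\<omega>. H \<bullet> increment S \<omega> = 0))"

definition martingale_measures ::
    "'a measure \<Rightarrow> 'a measure set \<Rightarrow> (real ^ 'd) \<times> ('a \<Rightarrow> real ^ 'd) \<Rightarrow> 'a measure set" where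
  "martingale_measures M PP S =
     {Q \<in> prob_c M PP. \<forall>i. (\<integral>\<omega>. increment S \<omega> $ i \<partial>Q) = 0}"

(* In the library, absolutely_continuous P Q means Q << P. *)
definition dominated_martingale_measures ::
    "'a measure \<Rightarrow> 'a measure set \<Rightarrow> (real ^ 'd) \<times> ('a \<Rightarrow> real ^ 'd) \<Rightarrow> 'a measure set" where
  "dominated_martingale_measures M PP S =
     {Q \<in> martingale_measures M PP S. \<exists>P\<in>PP. absolutely_continuous P Q}"

end

theory Submission
  imports Defs
begin

text \<open>
  Write \<open>X\<close> for the increment of the market.  If every prior is dominated by a martingale measure
  \<open>Q\<close>, then a nonnegative gain \<open>H \<bullet> X\<close> has \<open>Q\<close>-expectation zero, so it vanishes almost surely under
  each such \<open>Q\<close> and hence under each prior.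

  For the converse the point is that no arbitrage with respect to all priors descends to a single
  prior dominating a given \<open>P\<close> (lemma \<open>countable_subfamily_detects_losses\<close>).  For every prior, the
  strategies that almost surely do not lose form a closed set.  The Lindelof property of
  the space of strategies therefore provides countably many priors such that a strategy
  that does not lose under any of these does not lose under any prior at all.  Countable convexity
  mixes them with \<open>P\<close> into one prior \<open>P'\<close>, for which the classical no arbitrage condition holds.

  The classical one-period theorem for \<open>P'\<close> (lemma \<open>exists_positive_bounded_deflator\<close>) comes from a
  separation argument in finite dimension: the vectors \<open>E[Z X]\<close>, with \<open>Z\<close> bounded and strictly
  positive, form a convex set; a hyperplane separating it from \<open>0\<close> would have as its normal
  vector a nonlosing strategy, so by no arbitrage one whose gain vanishes, and such a vector
  cannot separate inside the span of that set.  Normalizing \<open>Z\<close> gives a density of \<open>Q\<close> with respect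
  to \<open>P'\<close>, and \<open>Q\<close> and \<open>P'\<close> have the same null sets because \<open>Z\<close> is positive.
\<close>

lemma quasi_surely_iff_AE:
  assumes PP: "PP \<subseteq> space (prob_algebra M)" and [measurable]: "Measurable.pred M \<phi>"
  shows "quasi_surely M PP \<phi> \<longleftrightarrow> (\<forall>P\<in>PP. AE \<omega> in P. \<phi> \<omega>)"
proof
  assume "quasi_surely M PP \<phi>"
  then obtain N where N: "N \<in> sets M" "capacity PP N = 0" "\<forall>\<omega>\<in>space M - N. \<phi> \<omega>"
    by (auto simp: quasi_surely_def polar_def)
  show "\<forall>P\<in>PP. AE \<omega> in P. \<phi> \<omega>"
  proof
    fix P assume P: "P \<in> PP"
    have sP: "sets P = sets M" using P PP by (auto simp: space_prob_algebra)
    have "emeasure P N \<le> capacity PP N" unfolding capacity_def using P by (rule SUP_upper)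
    then have "N \<in> null_sets P" using N sP by (auto simp: null_sets_def)
    then show "AE \<omega> in P. \<phi> \<omega>"
      by (rule AE_I') (use N sets_eq_imp_space_eq[OF sP] in auto)
  qed
next
  assume AE: "\<forall>P\<in>PP. AE \<omega> in P. \<phi> \<omega>"
  let ?N = "{\<omega>\<in>space M. \<not> \<phi> \<omega>}"
  have "emeasure P ?N = 0" if P: "P \<in> PP" for P
  proof -
    have sP: "sets P = sets M" using P PP by (auto simp: space_prob_algebra)
    have N: "{\<omega>\<in>space P. \<not> \<phi> \<omega>} \<in> sets P"
      unfolding sP sets_eq_imp_space_eq[OF sP] by measurable
    show ?thesis
      using AE_iff_measurable[OF N refl] AE P sets_eq_imp_space_eq[OF sP] by auto
  qed
  then have "capacity PP ?N = 0" by (simp add: capacity_def bot_ennreal[symmetric] SUP_eq_iff)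
  moreover have "?N \<in> sets M" by measurable
  ultimately show "quasi_surely M PP \<phi>"
    unfolding quasi_surely_def polar_def by (intro exI[of _ ?N]) simp
qed

text \<open>
  The nonlosing property survives limits because countably many almost sure statements hold
  simultaneously.
\<close>

lemma closed_nonlosing_strategies:
  fixes X :: "'a \<Rightarrow> 'b::real_inner"
  shows "closed {H. AE \<omega> in P. 0 \<le> H \<bullet> X \<omega>}"
  unfolding closed_sequential_limits
proof (intro allI impI, elim conjE)
  fix h H assume h: "\<forall>n. h n \<in> {H. AE \<omega> in P. 0 \<le> H \<bullet> X \<omega>}" and lim: "h \<longlonglongrightarrow> H"
  have "AE \<omega> in P. \<forall>n::nat. 0 \<le> h n \<bullet> X \<omega>" using h by (simp add: AE_all_countable)
  then have "AE \<omega> in P. 0 \<le> H \<bullet> X \<omega>"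
  proof eventually_elim
    case (elim \<omega>)
    have "(\<lambda>n. h n \<bullet> X \<omega>) \<longlonglongrightarrow> H \<bullet> X \<omega>" using lim by (intro tendsto_intros)
    then show ?case by (rule LIMSEQ_le_const) (use elim in auto)
  qed
  then show "H \<in> {H. AE \<omega> in P. 0 \<le> H \<bullet> X \<omega>}" by simp
qed

lemma countable_subfamily_detects_losses:
  fixes X :: "'a \<Rightarrow> 'b::euclidean_space"
  obtains PP' where "countable PP'" and "PP' \<subseteq> PP"
    and "\<And>H. \<forall>P\<in>PP'. AE \<omega> in P. 0 \<le> H \<bullet> X \<omega> \<Longrightarrow> \<forall>P\<in>PP. AE \<omega> in P. 0 \<le> H \<bullet> X \<omega>"
proof -
  \<comment> \<open>the strategies exposed to losses under \<open>P\<close>\<close>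
  define U where "U P = - {H. AE \<omega> in P. 0 \<le> H \<bullet> X \<omega>}" for P
  have "\<And>V. V \<in> U ` PP \<Longrightarrow> open V"
    unfolding U_def using closed_nonlosing_strategies by auto
  then obtain \<V> where \<V>: "\<V> \<subseteq> U ` PP" "countable \<V>" "\<Union>\<V> = \<Union>(U ` PP)"
    by (rule Lindelof)
  then obtain PP' where PP': "countable PP'" "PP' \<subseteq> PP" "\<V> = U ` PP'"
    by (meson countable_subset_image)
  show ?thesis
  proof (rule that[OF PP'(1,2)])
    fix H assume "\<forall>P\<in>PP'. AE \<omega> in P. 0 \<le> H \<bullet> X \<omega>"
    then have "H \<notin> \<Union>(U ` PP)" using \<V>(3) PP'(3) by (auto simp: U_def)
    then show "\<forall>P\<in>PP. AE \<omega> in P. 0 \<le> H \<bullet> X \<omega>" by (auto simp: U_def)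
  qed
qed

lemma countably_convex_dominating_prior:
  assumes PP: "PP \<subseteq> space (prob_algebra M)" and "countably_convex M PP"
    and "countable PP'" and "PP' \<subseteq> PP" and "PP' \<noteq> {}"
  obtains P' where "P' \<in> PP" and "\<And>P. P \<in> PP' \<Longrightarrow> absolutely_continuous P' P"
proof -
  define p where "p = from_nat_into PP'"
  have p: "range p = PP'" unfolding p_def using assms(3,5) by simp
  define P' where "P' = countable_mixture M (\<lambda>n. (1/2)^Suc n) p"
  have "\<forall>n. p n \<in> PP" using p assms by blast
  then have P': "P' \<in> PP"
    using assms(2) power_half_series unfolding countably_convex_def P'_def by fastforce
  have sets_p: "sets (p n) = sets M" for n
    using \<open>\<forall>n. p n \<in> PP\<close> PP by (auto simp: space_prob_algebra)
  have "absolutely_continuous P' P" if P: "P \<in> PP'" for P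
  proof -
    obtain n where n: "P = p n" using P p by blast
    show ?thesis unfolding absolutely_continuous_def
    proof
      fix N assume N: "N \<in> null_sets P'"
      have NM: "N \<in> sets M" using N P' PP by (auto simp: space_prob_algebra null_sets_def)
      have "(\<Sum>n. ennreal ((1/2)^Suc n) * emeasure (p n) N) = 0"
        using N emeasure_countable_mixture[of p M N, OF sets_p NM]
        by (simp add: P'_def null_sets_def)
      then have "ennreal ((1/2)^Suc n) * emeasure (p n) N = 0"
        by (metis suminf_eq_zero_iff summableI zero_le)
      moreover have "0 < ennreal ((1/2)^Suc n)" by (subst ennreal_less_zero_iff) simp
      ultimately have "emeasure (p n) N = 0" by (metis mult_eq_0_iff less_irrefl)
      then show "N \<in> null_sets P" using NM n sets_p by (auto simp: null_sets_def)
    qed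
  qed
  then show ?thesis using that P' by blast
qed

lemma (in finite_measure) integrable_scaled_bounded:
  fixes X :: "'a \<Rightarrow> 'b::euclidean_space"
  assumes "X \<in> borel_measurable M" "bounded (X ` space M)"
    and "Z \<in> borel_measurable M" "\<And>\<omega>. \<bar>Z \<omega>\<bar> \<le> (K::real)"
  shows "integrable M (\<lambda>\<omega>. Z \<omega> *\<^sub>R X \<omega>)"
proof -
  obtain B where B: "\<And>\<omega>. \<omega> \<in> space M \<Longrightarrow> norm (X \<omega>) \<le> B"
    using assms(2) unfolding bounded_iff by auto
  have "norm (Z \<omega> *\<^sub>R X \<omega>) \<le> K * B" if "\<omega> \<in> space M" for \<omega>
    using mult_mono[OF assms(4) B[OF that]] order_trans[OF abs_ge_zero assms(4)] by simp
  then show ?thesis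
    using assms(1,3) by (intro integrable_const_bound[where B="K * B"] AE_I2) auto
qed

text \<open>
  Testing against \<open>indicator {Y < 0}\<close> would give the claim at once; that weight is not strictly
  positive, so it is approximated by \<open>indicator {Y < 0} + \<epsilon>\<close>.
\<close>

lemma (in finite_measure) AE_nonneg_if_positive_weights_nonneg:
  fixes Y :: "'a \<Rightarrow> real"
  assumes Y: "integrable M Y"
    and weights: "\<And>Z K. Z \<in> borel_measurable M \<Longrightarrow> (\<And>\<omega>. 0 < Z \<omega>) \<Longrightarrow> (\<And>\<omega>. Z \<omega> \<le> K) \<Longrightarrow>
             0 \<le> (\<integral>\<omega>. Z \<omega> * Y \<omega> \<partial>M)"
  shows "AE \<omega> in M. 0 \<le> Y \<omega>"
proof -
  have [measurable]: "Y \<in> borel_measurable M" using Y by simp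
  define I where "I \<omega> = (if Y \<omega> < 0 then 1 else 0 :: real)" for \<omega>
  have I[measurable]: "I \<in> borel_measurable M" unfolding I_def by measurable
  have IY: "integrable M (\<lambda>\<omega>. I \<omega> * Y \<omega>)"
    by (rule Bochner_Integration.integrable_bound[OF Y]) (auto simp: I_def)
  have pos: "0 \<le> (\<integral>\<omega>. I \<omega> * Y \<omega> \<partial>M) + \<epsilon> * (\<integral>\<omega>. Y \<omega> \<partial>M)" if "\<epsilon> > 0" for \<epsilon>
  proof -
    have "0 \<le> (\<integral>\<omega>. (I \<omega> + \<epsilon>) * Y \<omega> \<partial>M)"
      by (rule weights[where K="1 + \<epsilon>"]) (use that in \<open>auto simp: I_def\<close>)
    also have "\<dots> = (\<integral>\<omega>. I \<omega> * Y \<omega> \<partial>M) + \<epsilon> * (\<integral>\<omega>. Y \<omega> \<partial>M)"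
      using IY Y by (simp add: distrib_right)
    finally show ?thesis .
  qed
  have "((\<lambda>\<epsilon>. (\<integral>\<omega>. I \<omega> * Y \<omega> \<partial>M) + \<epsilon> * (\<integral>\<omega>. Y \<omega> \<partial>M)) \<longlongrightarrow>
      (\<integral>\<omega>. I \<omega> * Y \<omega> \<partial>M) + 0 * (\<integral>\<omega>. Y \<omega> \<partial>M)) (at_right 0)"
    by (intro tendsto_intros)
  then have "0 \<le> (\<integral>\<omega>. I \<omega> * Y \<omega> \<partial>M) + 0 * (\<integral>\<omega>. Y \<omega> \<partial>M)"
    by (rule tendsto_lowerbound) (use pos in \<open>auto intro!: eventually_at_rightI[of 0 1]\<close>)
  moreover have "0 \<le> (\<integral>\<omega>. - (I \<omega> * Y \<omega>) \<partial>M)"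
    by (rule Bochner_Integration.integral_nonneg) (auto simp: I_def)
  ultimately have "(\<integral>\<omega>. - (I \<omega> * Y \<omega>) \<partial>M) = 0" by simp
  then have "AE \<omega> in M. - (I \<omega> * Y \<omega>) = 0"
    using integral_nonneg_eq_0_iff_AE[of M "\<lambda>\<omega>. - (I \<omega> * Y \<omega>)"] IY by (simp add: I_def)
  then show ?thesis by eventually_elim (auto simp: I_def split: if_splits)
qed

text \<open>
  The set \<open>C\<close> of weighted means need not have interior points, as \<open>X\<close> may be confined to a
  subspace.  A normal vector of a separating hyperplane is only useful if it is chosen in the span
  of \<open>C\<close>: no arbitrage makes it orthogonal to \<open>C\<close>, hence to itself.
\<close>

lemma (in finite_measure) exists_positive_bounded_deflator:
  fixes X :: "'a \<Rightarrow> 'b::euclidean_space"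
  assumes X: "X \<in> borel_measurable M" "bounded (X ` space M)"
    and NA: "\<And>H. AE \<omega> in M. 0 \<le> H \<bullet> X \<omega> \<Longrightarrow> AE \<omega> in M. H \<bullet> X \<omega> = 0"
  obtains Z K where "Z \<in> borel_measurable M" and "\<And>\<omega>. 0 < Z \<omega>" and "\<And>\<omega>. Z \<omega> \<le> (K::real)"
    and "(\<integral>\<omega>. Z \<omega> *\<^sub>R X \<omega> \<partial>M) = 0"
proof -
  define \<Z> where
    "\<Z> = {Z \<in> borel_measurable M. (\<forall>\<omega>. 0 < Z \<omega>) \<and> (\<exists>K::real. \<forall>\<omega>. Z \<omega> \<le> K)}"
  define C where "C = (\<lambda>Z. \<integral>\<omega>. Z \<omega> *\<^sub>R X \<omega> \<partial>M) ` \<Z>"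
  have int: "integrable M (\<lambda>\<omega>. Z \<omega> *\<^sub>R X \<omega>)" if Z: "Z \<in> \<Z>" for Z
  proof -
    obtain K where K: "\<And>\<omega>. Z \<omega> \<le> K" "\<And>\<omega>. 0 < Z \<omega>" "Z \<in> borel_measurable M"
      using Z unfolding \<Z>_def by auto
    then have "\<And>\<omega>. \<bar>Z \<omega>\<bar> \<le> K" by (simp add: less_imp_le)
    with K show ?thesis using X by (intro integrable_scaled_bounded)
  qed
  have inner: "H \<bullet> (\<integral>\<omega>. Z \<omega> *\<^sub>R X \<omega> \<partial>M) = (\<integral>\<omega>. Z \<omega> * (H \<bullet> X \<omega>) \<partial>M)" if "Z \<in> \<Z>" for Z H
    using integral_inner_right[OF int[OF that], of H] by simp
  have "0 \<in> C"
  proof (rule ccontr)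
    assume "0 \<notin> C"
    have "(\<lambda>_. 1) \<in> \<Z>" by (auto simp: \<Z>_def)
    then have "C \<noteq> {}" by (auto simp: C_def)
    have "convex C"
    proof (rule convexI)
      fix x y u v assume xy: "x \<in> C" "y \<in> C" and uv: "0 \<le> u" "0 \<le> v" "u + v = (1::real)"
      obtain Z W where Z: "Z \<in> \<Z>" "x = (\<integral>\<omega>. Z \<omega> *\<^sub>R X \<omega> \<partial>M)"
        and W: "W \<in> \<Z>" "y = (\<integral>\<omega>. W \<omega> *\<^sub>R X \<omega> \<partial>M)" using xy by (auto simp: C_def)
      obtain K L where KL: "\<And>\<omega>. Z \<omega> \<le> K" "\<And>\<omega>. W \<omega> \<le> L"
        using Z(1) W(1) unfolding \<Z>_def by auto
      have m[measurable]: "Z \<in> borel_measurable M" "W \<in> borel_measurable M"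
        and p: "\<And>\<omega>. 0 < Z \<omega>" "\<And>\<omega>. 0 < W \<omega>"
        using Z(1) W(1) by (auto simp: \<Z>_def)
      have "u * Z \<omega> + v * W \<omega> \<le> u * K + v * L" for \<omega>
        using uv KL by (intro add_mono mult_left_mono)
      moreover have "0 < u * Z \<omega> + v * W \<omega>" for \<omega>
        using uv p[of \<omega>]
        by (cases "u = 0") (auto intro!: add_pos_nonneg mult_pos_pos mult_nonneg_nonneg simp: less_imp_le)
      ultimately have mem: "(\<lambda>\<omega>. u * Z \<omega> + v * W \<omega>) \<in> \<Z>"
        unfolding \<Z>_def by auto
      have eq: "u *\<^sub>R x + v *\<^sub>R y = (\<integral>\<omega>. (u * Z \<omega> + v * W \<omega>) *\<^sub>R X \<omega> \<partial>M)"
        using int[OF Z(1)] int[OF W(1)] unfolding Z(2) W(2)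
        by (simp add: scaleR_add_left flip: scaleR_scaleR)
      show "u *\<^sub>R x + v *\<^sub>R y \<in> C" unfolding C_def using eq mem by (rule image_eqI)
    qed
    then obtain a where a: "a \<in> span C" "a \<noteq> 0" "\<And>x. x \<in> C \<Longrightarrow> 0 \<le> a \<bullet> x"
      using separating_hyperplane_set_0_inspan[OF _ \<open>C \<noteq> {}\<close> \<open>0 \<notin> C\<close>] by blast
    have "AE \<omega> in M. 0 \<le> a \<bullet> X \<omega>"
    proof (rule AE_nonneg_if_positive_weights_nonneg)
      show "integrable M (\<lambda>\<omega>. a \<bullet> X \<omega>)"
        using int[OF \<open>(\<lambda>_. 1) \<in> \<Z>\<close>] by simp
    next
      fix Z K assume "Z \<in> borel_measurable M" "\<And>\<omega>. 0 < Z \<omega>" "\<And>\<omega>. Z \<omega> \<le> (K::real)"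
      then have Z: "Z \<in> \<Z>" by (auto simp: \<Z>_def)
      then have "0 \<le> a \<bullet> (\<integral>\<omega>. Z \<omega> *\<^sub>R X \<omega> \<partial>M)" using a(3) by (auto simp: C_def)
      then show "0 \<le> (\<integral>\<omega>. Z \<omega> * (a \<bullet> X \<omega>) \<partial>M)" using inner[OF Z, of a] by simp
    qed
    then have zero: "AE \<omega> in M. a \<bullet> X \<omega> = 0" by (rule NA)
    have "a \<bullet> x = 0" if x: "x \<in> C" for x
    proof -
      obtain Z where Z: "Z \<in> \<Z>" "x = (\<integral>\<omega>. Z \<omega> *\<^sub>R X \<omega> \<partial>M)" using x by (auto simp: C_def)
      have "(\<integral>\<omega>. Z \<omega> * (a \<bullet> X \<omega>) \<partial>M) = 0"
        using zero by (intro integral_eq_zero_AE) auto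
      then show ?thesis using inner[OF Z(1), of a] Z(2) by simp
    qed
    then have "orthogonal a a"
      using a(1) by (intro orthogonal_to_span[of a C a]) (auto simp: orthogonal_def)
    then show False using a(2) by (simp add: orthogonal_def)
  qed
  then obtain Z where "Z \<in> \<Z>" "(\<integral>\<omega>. Z \<omega> *\<^sub>R X \<omega> \<partial>M) = 0" by (auto simp: C_def)
  then show ?thesis using that unfolding \<Z>_def by auto
qed

lemma (in prob_space) exists_equivalent_martingale_measure:
  fixes X :: "'a \<Rightarrow> 'b::euclidean_space"
  assumes X: "X \<in> borel_measurable M" "bounded (X ` space M)"
    and NA: "\<And>H. AE \<omega> in M. 0 \<le> H \<bullet> X \<omega> \<Longrightarrow> AE \<omega> in M. H \<bullet> X \<omega> = 0"
  obtains Q where "prob_space Q" and "sets Q = sets M" and "null_sets Q = null_sets M"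
    and "integrable Q X" and "(\<integral>\<omega>. X \<omega> \<partial>Q) = 0"
proof -
  obtain Z K where [measurable]: "Z \<in> borel_measurable M" and pos: "\<And>\<omega>. 0 < Z \<omega>"
    and bd: "\<And>\<omega>. Z \<omega> \<le> (K::real)" and mean: "(\<integral>\<omega>. Z \<omega> *\<^sub>R X \<omega> \<partial>M) = 0"
    using exists_positive_bounded_deflator[OF X NA] by metis
  have Zint: "integrable M Z"
    using pos bd by (intro integrable_const_bound[where B=K] AE_I2) (auto simp: less_imp_le)
  define c where "c = (\<integral>\<omega>. Z \<omega> \<partial>M)"
  have "c \<noteq> 0"
  proof
    assume "c = 0"
    then have "AE \<omega> in M. Z \<omega> = 0"
      using integral_nonneg_eq_0_iff_AE[OF Zint] pos by (simp add: c_def less_imp_le)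
    then have "AE \<omega> in M. False" by eventually_elim (metis pos less_irrefl)
    then show False by simp
  qed
  then have c: "c > 0"
    using pos Bochner_Integration.integral_nonneg[of M Z] by (simp add: c_def less_le)
  define f where "f \<omega> = Z \<omega> / c" for \<omega>
  have f_pos: "0 < f \<omega>" for \<omega> using pos c by (simp add: f_def)
  have f_ne: "ennreal (f \<omega>) \<noteq> 0" for \<omega> using f_pos[of \<omega>] by (simp add: ennreal_eq_0_iff not_le)
  have [measurable]: "f \<in> borel_measurable M" unfolding f_def by measurable
  define Q where "Q = density M (\<lambda>\<omega>. ennreal (f \<omega>))"
  have sets_Q: "sets Q = sets M" by (simp add: Q_def)
  have "emeasure Q (space Q) = (\<integral>\<^sup>+\<omega>. f \<omega> \<partial>M)"
    unfolding Q_def by (simp add: emeasure_density cong: nn_integral_cong)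
  also have "\<dots> = ennreal (\<integral>\<omega>. f \<omega> \<partial>M)"
    using Zint f_pos by (intro nn_integral_eq_integral) (auto simp: f_def less_imp_le)
  also have "\<dots> = 1" using c by (simp add: f_def flip: c_def)
  finally have prob: "prob_space Q" by (rule prob_spaceI)
  have null: "null_sets Q = null_sets M"
  proof (intro set_eqI)
    fix N
    have "(N \<in> null_sets Q) \<longleftrightarrow> N \<in> sets M \<and> (AE \<omega> in M. \<omega> \<in> N \<longrightarrow> ennreal (f \<omega>) = 0)"
      unfolding Q_def by (rule null_sets_density_iff) measurable
    also have "\<dots> \<longleftrightarrow> N \<in> sets M \<and> (AE \<omega> in M. \<omega> \<notin> N)"
      using f_ne by simp
    also have "\<dots> \<longleftrightarrow> N \<in> null_sets M" by (metis AE_iff_null_sets null_setsD2)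
    finally show "(N \<in> null_sets Q) \<longleftrightarrow> N \<in> null_sets M" .
  qed
  have "\<bar>f \<omega>\<bar> \<le> K / c" for \<omega>
    using pos[of \<omega>] bd[of \<omega>] c by (simp add: f_def divide_right_mono)
  then have "integrable M (\<lambda>\<omega>. f \<omega> *\<^sub>R X \<omega>)"
    using X by (intro integrable_scaled_bounded) auto
  then have "integrable Q X"
    unfolding Q_def using X(1) f_pos by (subst integrable_density) (auto simp: less_imp_le)
  moreover have "(\<integral>\<omega>. X \<omega> \<partial>Q) = (\<integral>\<omega>. (1 / c) *\<^sub>R (Z \<omega> *\<^sub>R X \<omega>) \<partial>M)"
    unfolding Q_def using X(1) f_pos
    by (subst integral_density) (auto simp: f_def less_imp_le)
  then have "(\<integral>\<omega>. X \<omega> \<partial>Q) = 0"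
    by (simp add: mean del: scaleR_scaleR)
  ultimately show ?thesis using that prob sets_Q null by blast
qed

theorem corollary4p37:
  fixes M :: "'a measure" and PP :: "'a measure set"
    and S :: "(real ^ 'd) \<times> ('a \<Rightarrow> real ^ 'd)"
  assumes "PP \<subseteq> space (prob_algebra M)" and "PP \<noteq> {}"
    and "\<forall>P\<in>PP. supported M PP P"
    and "countably_convex M PP"
    and "S \<in> market_models M"
  shows "no_arbitrage M PP S \<longleftrightarrow>
    (\<forall>P\<in>PP. \<exists>Q\<in>dominated_martingale_measures M PP S. absolutely_continuous Q P)"
proof -
  let ?X = "increment S"
  have [measurable]: "snd S \<in> borel_measurable M" and "bounded (snd S ` space M)"
    using assms(5) by (auto simp: market_models_def)
  have X[measurable]: "?X \<in> borel_measurable M" unfolding increment_def by measurable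
  have bX: "bounded (?X ` space M)"
    using bounded_translation_minus[OF \<open>bounded (snd S ` space M)\<close>, of "fst S"]
    by (simp add: increment_def image_image)
  have prior: "sets P = sets M" "space P = space M" "prob_space P" if "P \<in> PP" for P
    using that assms(1) sets_eq_imp_space_eq[of P M] by (auto simp: space_prob_algebra)
  have NA_iff: "no_arbitrage M PP S \<longleftrightarrow>
      (\<forall>H. (\<forall>P\<in>PP. AE \<omega> in P. 0 \<le> H \<bullet> ?X \<omega>) \<longrightarrow> (\<forall>P\<in>PP. AE \<omega> in P. H \<bullet> ?X \<omega> = 0))"
    unfolding no_arbitrage_def by (simp add: quasi_surely_iff_AE[OF assms(1)])
  show ?thesis
  proof
    assume NA: "no_arbitrage M PP S"
    show "\<forall>P\<in>PP. \<exists>Q\<in>dominated_martingale_measures M PP S. absolutely_continuous Q P"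
    proof
      fix P assume P: "P \<in> PP"
      obtain PP' where PP': "countable PP'" "PP' \<subseteq> PP"
        and detect: "\<And>H. \<forall>P\<in>PP'. AE \<omega> in P. 0 \<le> H \<bullet> ?X \<omega> \<Longrightarrow>
              \<forall>P\<in>PP. AE \<omega> in P. 0 \<le> H \<bullet> ?X \<omega>"
        using countable_subfamily_detects_losses[of PP ?X] by metis
      \<comment> \<open>Mixing in \<open>P\<close> itself makes the equivalent martingale measure of \<open>P'\<close> dominate \<open>P\<close>.\<close>
      obtain P' where P': "P' \<in> PP"
        and dom: "\<And>R. R \<in> insert P PP' \<Longrightarrow> absolutely_continuous P' R"
        using countably_convex_dominating_prior[OF assms(1,4), of "insert P PP'"] PP' P by auto
      interpret P': prob_space P' using prior[OF P'] by simp
      have "AE \<omega> in P'. H \<bullet> ?X \<omega> = 0" if H: "AE \<omega> in P'. 0 \<le> H \<bullet> ?X \<omega>" for H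
      proof -
        have "AE \<omega> in R. 0 \<le> H \<bullet> ?X \<omega>" if "R \<in> PP'" for R
        proof (rule absolutely_continuous_AE[OF _ dom H])
          have "R \<in> PP" using that PP' by auto
          then show "sets R = sets P'" using prior(1) P' by simp
        qed (use that in simp)
        then have "\<forall>R\<in>PP. AE \<omega> in R. 0 \<le> H \<bullet> ?X \<omega>" using detect by blast
        then show ?thesis using NA P' unfolding NA_iff by blast
      qed
      moreover have "?X \<in> borel_measurable P'"
        using X by (simp add: measurable_cong_sets[OF prior(1)[OF P'] refl])
      ultimately obtain Q where Q: "prob_space Q" "sets Q = sets P'" "null_sets Q = null_sets P'"
        "integrable Q ?X" "(\<integral>\<omega>. ?X \<omega> \<partial>Q) = 0"
        using P'.exists_equivalent_martingale_measure[of ?X] bX prior(2)[OF P'] by metis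
      have "emeasure Q N = 0" if "polar M PP N" for N
      proof -
        have "emeasure P' N \<le> capacity PP N" unfolding capacity_def using P' by (rule SUP_upper)
        then have "N \<in> null_sets P'"
          using that prior[OF P'] by (auto simp: polar_def null_sets_def)
        then show ?thesis using Q(3) by (metis null_setsD1)
      qed
      then have "Q \<in> prob_c M PP"
        using Q(1,2) prior[OF P'] by (auto simp: prob_c_def space_prob_algebra)
      moreover have "(\<integral>\<omega>. ?X \<omega> $ i \<partial>Q) = 0" for i
        using integral_inner_left[of "axis i 1" Q ?X] Q(4,5) by (simp add: inner_axis)
      ultimately have "Q \<in> dominated_martingale_measures M PP S"
        using P' Q(3) unfolding dominated_martingale_measures_def martingale_measures_def
        by (auto simp: absolutely_continuous_def)
      moreover have "absolutely_continuous Q P"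
        using dom[of P] Q(3) by (simp add: absolutely_continuous_def)
      ultimately show "\<exists>Q\<in>dominated_martingale_measures M PP S. absolutely_continuous Q P" ..
    qed
  next
    assume Q_ex: "\<forall>P\<in>PP. \<exists>Q\<in>dominated_martingale_measures M PP S. absolutely_continuous Q P"
    show "no_arbitrage M PP S" unfolding NA_iff
    proof (intro allI impI ballI)
      fix H P assume H: "\<forall>P\<in>PP. AE \<omega> in P. 0 \<le> H \<bullet> ?X \<omega>" and P: "P \<in> PP"
      obtain Q P' where ac: "absolutely_continuous Q P"
        and Q: "Q \<in> prob_c M PP" "\<And>i. (\<integral>\<omega>. ?X \<omega> $ i \<partial>Q) = 0"
        and P': "P' \<in> PP" "absolutely_continuous P' Q"
        using Q_ex P unfolding dominated_martingale_measures_def martingale_measures_def by blast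
      have sQ: "sets Q = sets M" "prob_space Q"
        using Q(1) by (auto simp: prob_c_def space_prob_algebra)
      interpret Q: prob_space Q by fact
      have XQ: "?X \<in> borel_measurable Q"
        using X by (simp add: measurable_cong_sets[OF sQ(1) refl])
      have int: "integrable Q ?X"
        using Q.integrable_scaled_bounded[OF XQ, of "\<lambda>_. 1" 1] bX sets_eq_imp_space_eq[OF sQ(1)]
        by simp
      have nonneg: "AE \<omega> in Q. 0 \<le> H \<bullet> ?X \<omega>"
        using absolutely_continuous_AE[OF _ P'(2)] H P'(1) prior(1)[OF P'(1)] sQ(1) by auto
      have "(\<integral>\<omega>. ?X \<omega> \<partial>Q) $ i = 0" for i
        using integral_inner_left[of "axis i 1" Q ?X] int Q(2)[of i] by (simp add: inner_axis)
      then have "(\<integral>\<omega>. ?X \<omega> \<partial>Q) = 0" by (simp add: vec_eq_iff)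
      then have "(\<integral>\<omega>. H \<bullet> ?X \<omega> \<partial>Q) = 0" using int by simp
      then have "AE \<omega> in Q. H \<bullet> ?X \<omega> = 0"
        using integral_nonneg_eq_0_iff_AE[of Q "\<lambda>\<omega>. H \<bullet> ?X \<omega>"] int nonneg by simp
      then show "AE \<omega> in P. H \<bullet> ?X \<omega> = 0"
        using absolutely_continuous_AE[OF _ ac] prior(1)[OF P] sQ(1) by auto
    qed
  qed
qed

end
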